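(* For $n\geq 3$ and $0\leq k\leq n$ with $n+k$ even, the number $i_n^k(\emptyset;321)$ of involutions of $\{1,\dots,n\}$ with exactly $k$ fixed points that contain the pattern $321$ exactly once equals $$\frac{k(k+3)}{n+1}\binom{n+1}{\frac{n-k}{2}-1}.$$
   Context: An involution is a permutation with $\pi^{-1}=\pi$; a fixed point is an $i$ with $\pi_i=i$. An occurrence of a pattern $\alpha\in S_m$ in $\pi\in S_n$ (one-line notation) is a set of indices $i_1<\dots<i_m$ such that $\pi_{i_1}\cdots\pi_{i_m}$ is order-isomorphic to $\alpha$; $\pi$ contains $\alpha$ exactly once if there is exactly one such occurrence. $\binom{a}{b}=0$ for $b<0$. *)

theory Defs
  imports Complex_Main "HOL-Combinatorics.Permutations"
begin

definition involutions :: "nat \<Rightarrow> (nat \<Rightarrow> nat) set" where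
  "involutions n = {\<pi>. \<pi> permutes {1..n} \<and> inv \<pi> = \<pi>}"

text \<open>Fixed points are counted inside \<open>{1..n}\<close>: as a total function, a permutation of
  \<open>{1..n}\<close> is the identity outside that set.\<close>

definition fixed_points :: "nat \<Rightarrow> (nat \<Rightarrow> nat) \<Rightarrow> nat set" where
  "fixed_points n \<pi> = {i \<in> {1..n}. \<pi> i = i}"

definition order_isomorphic :: "nat list \<Rightarrow> nat list \<Rightarrow> bool" where
  "order_isomorphic xs ys \<longleftrightarrow> length xs = length ys \<and>
     (\<forall>a < length xs. \<forall>b < length xs. xs ! a < xs ! b \<longleftrightarrow> ys ! a < ys ! b)"

text \<open>Patterns are words in one-line notation. For an index set \<open>I = {i\<^sub>1 < \<dots> < i\<^sub>m}\<close> the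
  word \<open>map \<pi> (sorted_list_of_set I)\<close> is \<open>[\<pi> i\<^sub>1, \<dots>, \<pi> i\<^sub>m]\<close>; the condition \<open>card I = m\<close> is part of
  order isomorphism, which compares lengths.\<close>

definition occurrences :: "nat list \<Rightarrow> nat \<Rightarrow> (nat \<Rightarrow> nat) \<Rightarrow> nat set set" where
  "occurrences \<alpha> n \<pi> =
     {I. I \<subseteq> {1..n} \<and> order_isomorphic (map \<pi> (sorted_list_of_set I)) \<alpha>}"

definition num_involutions_once :: "nat \<Rightarrow> nat \<Rightarrow> nat list \<Rightarrow> nat" where
  "num_involutions_once n k \<alpha> =
     card {\<pi> \<in> involutions n. card (fixed_points n \<pi>) = k \<and> card (occurrences \<alpha> n \<pi>) = 1}"

text \<open>Binomial coefficient with an integer lower index, zero when that index is negative.\<close>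

definition int_choose :: "nat \<Rightarrow> int \<Rightarrow> nat" where
  "int_choose a b = (if b < 0 then 0 else a choose nat b)"

end

theory Submission
  imports Defs
begin

text \<open>Scan an involution from the largest position downwards. The positions already read whose
  partner lies further to the left are the open arcs. With at most one occurrence of 321 no two
  arcs are nested, so an opening position is joined to the largest open arc; a fixed point under
  exactly one arc creates exactly one occurrence, and a fixed point under two arcs creates too
  many. Hence the involutions with \<open>k\<close> fixed points and no (or one) occurrence that end with \<open>h\<close>
  open arcs satisfy a linear recursion in the number of unread positions. The ballot numbers
  depending only on \<open>k + h\<close> solve the recursion without occurrences; inserting the unique covered
  fixed point gives \<open>k\<close> times the ballot number of height \<open>k + 2\<close> when \<open>h = 0\<close>.\<close>

section \<open>Open-arc matchings and their 321 triples\<close>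

text \<open>Ordered triples stand in for the index sets of \<open>occurrences\<close>, so that the
  role of each position in the pattern can be addressed.\<close>

definition triples321 :: "nat set \<Rightarrow> (nat \<Rightarrow> nat) \<Rightarrow> (nat \<times> nat \<times> nat) set" where
  "triples321 S \<pi> = {(a, b, c). a \<in> S \<and> b \<in> S \<and> c \<in> S \<and> a < b \<and> b < c \<and> \<pi> c < \<pi> b \<and> \<pi> b < \<pi> a}"

text \<open>\<open>M\<close> are the unread positions and \<open>H\<close>, which lies above \<open>M\<close> in all uses, the open arcs.\<close>

definition matchings :: "nat set \<Rightarrow> nat set \<Rightarrow> nat \<Rightarrow> nat \<Rightarrow> (nat \<Rightarrow> nat) set" where
  "matchings M H k r = {\<pi>. \<pi> permutes (M \<union> H) \<and> (\<forall>x. \<pi> (\<pi> x) = x) \<and> \<pi> ` H \<subseteq> M \<and>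
     card {x \<in> M \<union> H. \<pi> x = x} = k \<and> card (triples321 (M \<union> H) \<pi>) = r}"

lemma finite_triples321: "finite S \<Longrightarrow> finite (triples321 S \<pi>)"
  by (rule finite_subset[of _ "S \<times> S \<times> S"]) (auto simp: triples321_def)

lemma finite_matchings: "finite M \<Longrightarrow> finite H \<Longrightarrow> finite (matchings M H k r)"
  by (rule finite_subset[OF _ finite_permutations[of "M \<union> H"]]) (auto simp: matchings_def)

lemma two_triples:
  assumes "finite S" "card (triples321 S \<pi>) \<le> 1" "p \<in> triples321 S \<pi>" "q \<in> triples321 S \<pi>"
  shows "p = q"
  using assms finite_triples321[of S \<pi>] by (metis One_nat_def card_le_Suc0_iff_eq)

text \<open>Two nested arcs form a 4321, which contains more than one 321.\<close>

lemma matchings_mono: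
  assumes "finite M" "finite H" and MH: "\<And>x y. x \<in> M \<Longrightarrow> y \<in> H \<Longrightarrow> x < y"
    and \<pi>: "\<pi> \<in> matchings M H k r" and "r \<le> 1" and "b \<in> H" "c \<in> H" "b < c"
  shows "\<pi> b < \<pi> c"
proof (rule ccontr)
  assume "\<not> \<pi> b < \<pi> c"
  moreover have inv: "\<pi> (\<pi> x) = x" for x using \<pi> by (simp add: matchings_def)
  ultimately have lt: "\<pi> c < \<pi> b" using \<open>b < c\<close> by (metis linorder_neqE_nat nat_neq_iff)
  have M: "\<pi> b \<in> M" "\<pi> c \<in> M" using \<pi> assms by (auto simp: matchings_def)
  have "(\<pi> c, \<pi> b, b) \<in> triples321 (M \<union> H) \<pi>" "(\<pi> c, \<pi> b, c) \<in> triples321 (M \<union> H) \<pi>"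
    using lt M assms(6-8) MH[OF M(1) assms(6)] MH[OF M(1) assms(7)] by (auto simp: triples321_def inv)
  moreover have "card (triples321 (M \<union> H) \<pi>) \<le> 1" using \<pi> \<open>r \<le> 1\<close> by (simp add: matchings_def)
  ultimately have "(\<pi> c, \<pi> b, b) = (\<pi> c, \<pi> b, c)" using two_triples[of "M \<union> H" \<pi>] assms(1,2) by blast
  then show False using \<open>b < c\<close> by simp
qed

lemma permutes_remove_fixed:
  assumes "\<pi> x = x"
  shows "\<pi> permutes S \<longleftrightarrow> \<pi> permutes (S - {x})"
  using assms by (auto simp: permutes_def)

lemma involution_permutes:
  assumes "\<And>x. p (p x) = x" "\<And>x. x \<notin> S \<Longrightarrow> p x = x"
  shows "p permutes S"
  unfolding permutes_def using assms by metis

lemma card_fixed_remove: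
  assumes "finite S" "m \<in> S" "\<pi> m = m"
  shows "card {x \<in> S. \<pi> x = x} = Suc (card {x \<in> S - {m}. \<pi> x = x})"
proof -
  have "{x \<in> S. \<pi> x = x} = insert m {x \<in> S - {m}. \<pi> x = x}" using assms by auto
  then show ?thesis using assms by simp
qed

section \<open>Cases for the largest unread position\<close>

context
  fixes M H :: "nat set" and m :: nat
  assumes fin: "finite M" "finite H" and MH: "\<And>x y. x \<in> M \<Longrightarrow> y \<in> H \<Longrightarrow> x < y"
    and m: "m \<in> M" "\<And>x. x \<in> M \<Longrightarrow> x \<le> m"
begin

lemma below: "x \<in> M - {m} \<Longrightarrow> x < m"
  using m by force

lemma mnotH: "m \<notin> H"
  using MH m by blast

lemma Max_fixed_0:
  assumes "\<pi> \<in> matchings M H 0 r"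
  shows "\<pi> m \<noteq> m"
  using assms m fin by (auto simp: matchings_def)

text \<open>As the last position \<open>m\<close> could only end a triple, but it also carries the
  largest value. So deleting it costs a fixed point and no occurrence.\<close>

lemma Max_fixed_empty:
  assumes "H = {}"
  shows "{\<pi> \<in> matchings M H (Suc k) r. \<pi> m = m} = matchings (M - {m}) H k r"
proof -
  have *: "triples321 M \<pi> = triples321 (M - {m}) \<pi>" if p: "\<pi> permutes M" "\<pi> m = m" for \<pi>
  proof -
    have "\<pi> x \<le> m" if "x \<in> M" for x using p m that by (metis permutes_in_image)
    then show ?thesis using m that unfolding triples321_def by (fastforce)
  qed
  have m': "\<pi> m = m" if "\<pi> permutes (M - {m})" for \<pi> using that by (simp add: permutes_def)
  show ?thesis
  proof (intro set_eqI iffI)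
    fix \<pi> assume "\<pi> \<in> {\<pi> \<in> matchings M H (Suc k) r. \<pi> m = m}"
    then show "\<pi> \<in> matchings (M - {m}) H k r"
      using permutes_remove_fixed[of \<pi> m M] card_fixed_remove[of M m \<pi>] *[of \<pi>] fin m(1)
      by (simp add: matchings_def assms)
  next
    fix \<pi> assume a: "\<pi> \<in> matchings (M - {m}) H k r"
    then have "\<pi> m = m" using m' by (simp add: matchings_def assms)
    then show "\<pi> \<in> {\<pi> \<in> matchings M H (Suc k) r. \<pi> m = m}"
      using permutes_remove_fixed[of \<pi> m M] card_fixed_remove[of M m \<pi>] *[of \<pi>] fin m(1) a
      by (simp add: matchings_def assms)
  qed
qed

text \<open>Each open arc covers the fixed point: \<open>\<pi> y < m < y\<close> makes
  \<open>(\<pi> y, m, y)\<close> a triple, and different arcs give different triples.\<close>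

lemma Max_fixed_two:
  assumes "\<pi> \<in> matchings M H k r" "r \<le> 1" "y \<in> H" "z \<in> H" "\<pi> m = m"
  shows "y = z"
proof -
  have inv: "\<pi> (\<pi> x) = x" for x using assms by (simp add: matchings_def)
  have "(\<pi> y, m, y) \<in> triples321 (M \<union> H) \<pi>" if "y \<in> H" for y
  proof -
    have "\<pi> y \<in> M" using assms that by (auto simp: matchings_def)
    moreover have "\<pi> y \<noteq> m" using inv[of y] assms(5) mnotH that by metis
    ultimately have "\<pi> y < m" using below by auto
    then show ?thesis using that \<open>\<pi> y \<in> M\<close> m MH[of m y] by (auto simp: triples321_def inv assms(5))
  qed
  then have "(\<pi> y, m, y) \<in> triples321 (M \<union> H) \<pi>" "(\<pi> z, m, z) \<in> triples321 (M \<union> H) \<pi>"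
    using assms by auto
  moreover have "card (triples321 (M \<union> H) \<pi>) \<le> 1" using assms by (simp add: matchings_def)
  ultimately have "(\<pi> y, m, y) = (\<pi> z, m, z)" using two_triples[of "M \<union> H" \<pi>] fin by blast
  then show ?thesis by simp
qed

text \<open>Only the arc between \<open>\<pi> y\<close> and \<open>y\<close> passes over
  \<open>m\<close>, so the fixed point \<open>m\<close> takes part in exactly one triple.\<close>

lemma triples321_fixed_under_arc:
  assumes "H = {y}" "\<pi> permutes (M \<union> H)" "\<And>x. \<pi> (\<pi> x) = x" "\<pi> ` H \<subseteq> M" "\<pi> m = m"
  shows "triples321 (M \<union> H) \<pi> = insert (\<pi> y, m, y) (triples321 (M \<union> H - {m}) \<pi>)"
proof -
  have yM: "\<pi> y \<in> M" using assms by auto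
  have "\<pi> y \<noteq> m" using assms mnotH by (metis insertCI)
  then have ym: "\<pi> y < m" using below yM by auto
  have my: "m < y" using MH m assms by auto
  have le: "\<pi> x \<le> m" if "x \<in> M" "x \<noteq> \<pi> y" for x
  proof -
    have "\<pi> x \<in> M \<union> H" using that assms(2) by (metis UnCI permutes_in_image)
    moreover have "\<pi> x \<noteq> y" using that assms(3) by metis
    ultimately show ?thesis using m assms(1) by auto
  qed
  have sub: "(a, b, c) = (\<pi> y, m, y)"
    if t: "(a, b, c) \<in> triples321 (M \<union> H) \<pi>" and "a = m \<or> b = m \<or> c = m" for a b c
  proof -
    have t: "a \<in> M \<union> H" "b \<in> M \<union> H" "c \<in> M \<union> H" "a < b" "b < c" "\<pi> c < \<pi> b" "\<pi> b < \<pi> a"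
      using t by (auto simp: triples321_def)
    \<comment> \<open>Only \<open>y\<close> lies to the right of \<open>m\<close>, and left of
      \<open>y\<close> only \<open>\<pi> y\<close> has a value above \<open>m\<close>. Hence
      \<open>m\<close> is neither first nor last in a triple, and as the middle entry it determines
      the other two.\<close>
    have "x = y" if "x \<in> M \<union> H" "m < x" for x using that m assms(1) by force
    moreover have "x = \<pi> y" if "x \<in> M \<union> H" "x < y" "m < \<pi> x" for x
      using that le assms(1) by force
    moreover have "x = m \<or> x < m \<or> x = y" if "x \<in> M \<union> H" for x using that m assms(1) by force
    ultimately show ?thesis using t that(2) my ym assms(3,5)
      by (smt (verit) dual_order.strict_trans nat_neq_iff)
  qed
  have "(\<pi> y, m, y) \<in> triples321 (M \<union> H) \<pi>"
    using ym my yM m assms by (auto simp: triples321_def)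
  moreover have "(a, b, c) \<in> triples321 (M \<union> H - {m}) \<pi> \<longleftrightarrow>
      (a, b, c) \<in> triples321 (M \<union> H) \<pi> \<and> a \<noteq> m \<and> b \<noteq> m \<and> c \<noteq> m" for a b c
    by (auto simp: triples321_def)
  ultimately have "(a, b, c) \<in> triples321 (M \<union> H) \<pi> \<longleftrightarrow>
      (a, b, c) \<in> insert (\<pi> y, m, y) (triples321 (M \<union> H - {m}) \<pi>)" for a b c
    using sub[of a b c] by (metis insert_iff)
  then show ?thesis by (simp add: set_eq_iff split_paired_all)
qed

text \<open>The covered fixed point accounts for one occurrence, so its deletion lowers both
  parameters by one.\<close>

lemma Max_fixed_single:
  assumes "H = {y}"
  shows "{\<pi> \<in> matchings M H (Suc k) (Suc r). \<pi> m = m} = matchings (M - {m}) H k r"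
    and "{\<pi> \<in> matchings M H k 0. \<pi> m = m} = {}"
proof -
  have S: "M \<union> H - {m} = (M - {m}) \<union> H" using mnotH by auto
  have *: "card (triples321 (M \<union> H) \<pi>) = Suc (card (triples321 ((M - {m}) \<union> H) \<pi>))"
    if "\<pi> permutes (M \<union> H)" "\<And>x. \<pi> (\<pi> x) = x" "\<pi> ` H \<subseteq> M" "\<pi> m = m" for \<pi>
  proof -
    have "(\<pi> y, m, y) \<notin> triples321 ((M - {m}) \<union> H) \<pi>" using mnotH by (auto simp: triples321_def)
    then show ?thesis
      unfolding triples321_fixed_under_arc[OF assms that] S using fin finite_triples321 by simp
  qed
  have m': "\<pi> m = m" if "\<pi> permutes ((M - {m}) \<union> H)" for \<pi>
    using that mnotH by (simp add: permutes_def)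
  have img: "\<pi> ` H \<subseteq> M - {m} \<longleftrightarrow> \<pi> ` H \<subseteq> M" if "\<pi> m = m" "\<forall>x. \<pi> (\<pi> x) = x" for \<pi> :: "nat \<Rightarrow> nat"
  proof -
    have "\<pi> x \<noteq> m" if "x \<in> H" for x using that \<open>\<pi> m = m\<close> \<open>\<forall>x. \<pi> (\<pi> x) = x\<close> mnotH by metis
    then show ?thesis by auto
  qed
  have perm: "\<pi> permutes (M \<union> H) \<longleftrightarrow> \<pi> permutes ((M - {m}) \<union> H)" if "\<pi> m = m" for \<pi>
    using permutes_remove_fixed[of \<pi> m "M \<union> H"] that S by simp
  have fx: "card {x \<in> M \<union> H. \<pi> x = x} = Suc (card {x \<in> (M - {m}) \<union> H. \<pi> x = x})" if "\<pi> m = m" for \<pi>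
    using card_fixed_remove[of "M \<union> H" m \<pi>] that S fin m by simp
  show "{\<pi> \<in> matchings M H (Suc k) (Suc r). \<pi> m = m} = matchings (M - {m}) H k r" (is "?L = ?R")
  proof (intro set_eqI iffI)
    fix \<pi> assume "\<pi> \<in> ?L"
    then show "\<pi> \<in> ?R" using * perm img fx by (auto simp: matchings_def)
  next
    fix \<pi> assume a: "\<pi> \<in> ?R"
    then have mm: "\<pi> m = m" using m' by (auto simp: matchings_def)
    have "\<pi> permutes (M \<union> H)" "\<And>x. \<pi> (\<pi> x) = x" "\<pi> ` H \<subseteq> M"
      using a perm[of \<pi>, OF mm] by (auto simp: matchings_def)
    then show "\<pi> \<in> ?L" using mm a *[of \<pi>] fx[of \<pi>, OF mm] by (auto simp: matchings_def)
  qed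
  show "{\<pi> \<in> matchings M H k 0. \<pi> m = m} = {}"
  proof -
    have False if "\<pi> \<in> matchings M H k 0" "\<pi> m = m" for \<pi>
      using *[of \<pi>] that by (simp add: matchings_def)
    then show ?thesis by blast
  qed
qed

text \<open>Only the bookkeeping changes: the partner of \<open>m\<close> is still unread, so
  \<open>m\<close> moves from \<open>M\<close> to \<open>H\<close> while \<open>\<pi>\<close> and
  \<open>M \<union> H\<close> stay the same.\<close>

lemma Max_closer:
  "{\<pi> \<in> matchings M H k r. \<pi> m < m} = matchings (M - {m}) (insert m H) k r"
proof -
  have S: "(M - {m}) \<union> insert m H = M \<union> H" using m by auto
  have "(\<pi> ` H \<subseteq> M \<and> \<pi> m < m) \<longleftrightarrow> \<pi> ` insert m H \<subseteq> M - {m}"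
    if p: "\<pi> permutes (M \<union> H)" "\<And>x. \<pi> (\<pi> x) = x" for \<pi>
  proof
    assume a: "\<pi> ` H \<subseteq> M \<and> \<pi> m < m"
    have "\<pi> m \<in> M \<union> H" using p m by (metis UnI1 permutes_in_image)
    then have "\<pi> m \<in> M - {m}" using a MH[of m "\<pi> m"] m by auto
    moreover have "\<pi> y \<noteq> m" if "y \<in> H" for y
      using that p(2)[of y] a MH[of m y] m by auto
    ultimately show "\<pi> ` insert m H \<subseteq> M - {m}" using a by auto
  next
    assume a: "\<pi> ` insert m H \<subseteq> M - {m}"
    then show "\<pi> ` H \<subseteq> M \<and> \<pi> m < m" using below by auto
  qed
  then show ?thesis unfolding matchings_def S by blast
qed

lemma Max_opener_image:
  assumes "\<pi> \<in> matchings M H k r" "m < \<pi> m"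
  shows "\<pi> m \<in> H"
proof -
  have "\<pi> m \<in> M \<union> H" using assms m by (metis (no_types, lifting) UnI1 matchings_def mem_Collect_eq permutes_in_image)
  then show ?thesis using m assms by force
qed

text \<open>By monotonicity on \<open>H\<close> the partner of \<open>m\<close> is the largest open
  arc \<open>z\<close>. The arc between them meets no triple, so removing it is a bijection whose
  inverse joins \<open>m\<close> to \<open>z\<close>.\<close>

lemma Max_opener:
  assumes z: "z \<in> H" "\<And>y. y \<in> H \<Longrightarrow> y \<le> z" and r: "r \<le> 1"
  shows "card {\<pi> \<in> matchings M H k r. m < \<pi> m} = card (matchings (M - {m}) (H - {z}) k r)"
proof -
  let ?M = "M - {m}" and ?H = "H - {z}"
  have mz: "m < z" using MH m z by auto
  have zM: "z \<notin> M" using m mz by force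
  have S: "M \<union> H = insert m (insert z (?M \<union> ?H))" using m z by auto
  have nin: "m \<notin> ?M \<union> ?H" "z \<notin> ?M \<union> ?H" using mnotH zM by auto
  have MH': "\<And>x y. x \<in> ?M \<Longrightarrow> y \<in> ?H \<Longrightarrow> x < y" using MH by auto
  \<comment> \<open>Stated with \<open>\<pi>\<close> built from \<open>\<pi>'\<close>, so that it
    serves both directions of the bijection.\<close>
  have step: "triples321 (M \<union> H) \<pi> = triples321 (?M \<union> ?H) \<pi>'"
    if p: "\<pi>' permutes (?M \<union> ?H)" "\<And>x. \<pi>' (\<pi>' x) = x" "\<pi>' ` ?H \<subseteq> ?M"
      and mono: "\<And>b c. b \<in> ?H \<Longrightarrow> c \<in> ?H \<Longrightarrow> b < c \<Longrightarrow> \<pi>' b < \<pi>' c"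
      and \<pi>: "\<pi> = \<pi>'(m := z, z := m)" for \<pi> \<pi>'
  proof -
    have im: "\<pi>' x \<in> ?M \<union> ?H" if "x \<in> ?M \<union> ?H" for x using p(1) that by (metis permutes_in_image)
    have lez: "x < z" if "x \<in> ?M \<union> ?H" for x using that m(2) mz z(2) by force
    have Hgt: "m < x \<longleftrightarrow> x \<in> ?H" if "x \<in> ?M \<union> ?H" for x using that m(2) MH[of m x] m(1) by force
    have pH: "\<pi>' x < m" if "x \<in> ?H" for x using p(3) that below by auto
    have v: "\<pi> m = z" "\<pi> z = m" using \<pi> mz by auto
    have v': "\<pi> x = \<pi>' x" if "x \<in> ?M \<union> ?H" for x using \<pi> nin that by auto
    have none: "a \<in> ?M \<union> ?H \<and> b \<in> ?M \<union> ?H \<and> c \<in> ?M \<union> ?H"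
      if t: "a \<in> M \<union> H" "b \<in> M \<union> H" "c \<in> M \<union> H" "a < b" "b < c" "\<pi> c < \<pi> b" "\<pi> b < \<pi> a" for a b c
    proof -
      \<comment> \<open>\<open>z\<close> is the last position and also the largest value, taken at
        \<open>m\<close>. So \<open>z\<close> is neither first nor middle and \<open>m\<close>
        neither middle nor last; two cases remain.\<close>
      have top: "\<pi> x \<le> z" if "x \<in> M \<union> H" for x
        using that S v v' im lez mz by (metis insertE less_imp_le_nat order_refl)
      have topz: "x \<le> z" if "x \<in> M \<union> H" for x using that lez S mz by (metis insertE less_imp_le_nat order_refl)
      have bz: "b \<noteq> z" using topz[OF t(3)] t by simp
      have az: "a \<noteq> z" using topz[OF t(2)] t by simp
      have bm: "b \<noteq> m" using top[OF t(1)] t v by auto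
      have cm: "c \<noteq> m" using top[OF t(2)] t v by auto
      have b: "b \<in> ?M \<union> ?H" using bz bm t(2) by auto
      \<comment> \<open>If \<open>a = m\<close>, then \<open>b\<close> and \<open>c\<close> lie in
        \<open>H - {z}\<close>, where the values increase.\<close>
      have am: "a \<noteq> m"
      proof
        assume am: "a = m"
        then have bH: "b \<in> ?H" using Hgt[OF b] t by simp
        then have pb: "\<pi> b < m" using pH v'[OF b] by simp
        then have cz: "c \<noteq> z" using t v by auto
        then have c: "c \<in> ?M \<union> ?H" using t cm by auto
        then have "c \<in> ?H" using Hgt[OF c] t am by simp
        then show False using mono[OF bH, of c] t v' b c by auto
      qed
      then have a: "a \<in> ?M \<union> ?H" using az t by auto
      \<comment> \<open>The same seen through the involution: if \<open>c = z\<close>, the values of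
        \<open>a\<close> and \<open>b\<close> lie in \<open>H - {z}\<close>, and \<open>mono\<close>
        at these values gives \<open>b < a\<close>.\<close>
      have cz: "c \<noteq> z"
      proof
        assume "c = z"
        then have pb: "m < \<pi>' b" using t v v'[OF b] by simp
        then have 1: "\<pi>' b \<in> ?H" using Hgt[OF im[OF b]] by simp
        have "m < \<pi>' a" using pb t v'[OF a] v'[OF b] by simp
        then have 2: "\<pi>' a \<in> ?H" using Hgt[OF im[OF a]] by simp
        show False using mono[OF 1 2] t v'[OF a] v'[OF b] p(2) by auto
      qed
      then show ?thesis using a b t cm by auto
    qed
    have "(a, b, c) \<in> triples321 (M \<union> H) \<pi> \<longleftrightarrow> (a, b, c) \<in> triples321 (?M \<union> ?H) \<pi>'" for a b c
      using none[of a b c] v'[of a] v'[of b] v'[of c] by (auto simp: triples321_def)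
    then show ?thesis by auto
  qed
  have fx: "{x \<in> M \<union> H. (\<pi>'(m := z, z := m)) x = x} = {x \<in> ?M \<union> ?H. \<pi>' x = x}" for \<pi>' :: "nat \<Rightarrow> nat"
    using mz zM mnotH by auto
  have "bij_betw (\<lambda>\<pi>. \<pi>(m := m, z := z)) {\<pi> \<in> matchings M H k r. m < \<pi> m} (matchings ?M ?H k r)"
  proof (rule bij_betw_byWitness[where f' = "\<lambda>\<pi>. \<pi>(m := z, z := m)"])
    \<comment> \<open>If \<open>\<pi> m\<close> were below \<open>z\<close>, monotonicity on
      \<open>H\<close> would give \<open>m < \<pi> z\<close>, although \<open>m\<close> is the
      largest element of \<open>M\<close>.\<close>
    have max: "\<pi> m = z \<and> \<pi> z = m" if "\<pi> \<in> matchings M H k r" "m < \<pi> m" for \<pi>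
    proof -
      have inv: "\<pi> (\<pi> m) = m" "\<pi> (\<pi> z) = z" using that by (auto simp: matchings_def)
      have "\<pi> z \<in> M" using that z by (auto simp: matchings_def)
      then have "\<not> \<pi> m < z"
        using matchings_mono[OF fin MH that(1) r Max_opener_image[OF that] z(1)] inv m(2) by force
      then show ?thesis using Max_opener_image[OF that] z inv by force
    qed
    show "\<forall>\<pi> \<in> {\<pi> \<in> matchings M H k r. m < \<pi> m}. (\<pi>(m := m, z := z))(m := z, z := m) = \<pi>"
      using max by fastforce
    show "\<forall>\<pi> \<in> matchings ?M ?H k r. (\<pi>(m := z, z := m))(m := m, z := z) = \<pi>"
    proof
      fix \<pi> assume "\<pi> \<in> matchings ?M ?H k r"
      then have "\<pi> permutes (?M \<union> ?H)" by (simp add: matchings_def)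
      then have "\<pi> m = m" "\<pi> z = z" using permutes_not_in nin by metis+
      then show "(\<pi>(m := z, z := m))(m := m, z := z) = \<pi>" by (simp add: fun_eq_iff)
    qed
    show "(\<lambda>\<pi>. \<pi>(m := m, z := z)) ` {\<pi> \<in> matchings M H k r. m < \<pi> m} \<subseteq> matchings ?M ?H k r"
    proof clarify
      fix \<pi> assume a: "\<pi> \<in> matchings M H k r" "m < \<pi> m"
      let ?p = "\<pi>(m := m, z := z)"
      have v: "\<pi> m = z" "\<pi> z = m" using max[OF a] by auto
      have inv: "\<pi> (\<pi> x) = x" for x using a by (simp add: matchings_def)
      have inv': "?p (?p x) = x" for x using inv v by (metis fun_upd_apply)
      have perm: "?p permutes (?M \<union> ?H)"
      proof (rule involution_permutes)
        show "?p (?p x) = x" for x by (rule inv')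
        show "?p x = x" if "x \<notin> ?M \<union> ?H" for x
          using that a(1) by (auto simp: matchings_def permutes_def)
      qed
      have img: "?p ` ?H \<subseteq> ?M"
      proof
        fix w assume "w \<in> ?p ` ?H"
        then obtain x where x: "x \<in> ?H" "w = \<pi> x" using mnotH by auto
        then have "w \<in> M" using a(1) by (auto simp: matchings_def)
        moreover have "w \<noteq> m" using x v inv by (metis DiffD2 singletonI)
        ultimately show "w \<in> ?M" by simp
      qed
      have restore: "\<pi> = ?p(m := z, z := m)" using v by (auto simp: fun_eq_iff)
      have mono: "?p b < ?p c" if "b \<in> ?H" "c \<in> ?H" "b < c" for b c
        using matchings_mono[OF fin MH a(1) r, of b c] that mnotH by auto
      have "triples321 (M \<union> H) \<pi> = triples321 (?M \<union> ?H) ?p"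
        by (rule step[OF perm inv' img mono restore])
      moreover have "{x \<in> M \<union> H. \<pi> x = x} = {x \<in> ?M \<union> ?H. ?p x = x}"
        using fx[of ?p] unfolding restore[symmetric] .
      moreover have "card {x \<in> M \<union> H. \<pi> x = x} = k" "card (triples321 (M \<union> H) \<pi>) = r"
        using a(1) by (simp_all add: matchings_def)
      ultimately have "card {x \<in> ?M \<union> ?H. ?p x = x} = k" "card (triples321 (?M \<union> ?H) ?p) = r"
        by (simp_all only:)
      then show "?p \<in> matchings ?M ?H k r"
        unfolding matchings_def mem_Collect_eq using perm inv' img by blast
    qed
    show "(\<lambda>\<pi>. \<pi>(m := z, z := m)) ` matchings ?M ?H k r \<subseteq> {\<pi> \<in> matchings M H k r. m < \<pi> m}"
    proof clarify
      fix \<pi> assume a: "\<pi> \<in> matchings ?M ?H k r"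
      let ?p = "\<pi>(m := z, z := m)"
      have inv: "\<pi> (\<pi> x) = x" for x using a by (simp add: matchings_def)
      have p: "\<pi> permutes (?M \<union> ?H)" and img: "\<pi> ` ?H \<subseteq> ?M" using a by (auto simp: matchings_def)
      have fixd: "\<pi> m = m" "\<pi> z = z" using permutes_not_in[OF p] nin by metis+
      have inv': "?p (?p x) = x" for x using inv fixd by (metis fun_upd_apply)
      have perm: "?p permutes (M \<union> H)"
      proof (rule involution_permutes)
        show "?p (?p x) = x" for x by (rule inv')
        show "?p x = x" if "x \<notin> M \<union> H" for x
          using that p m(1) z(1) by (auto simp: permutes_def)
      qed
      have img': "?p ` H \<subseteq> M" using img m mnotH by auto
      have mono: "\<pi> b < \<pi> c" if "b \<in> ?H" "c \<in> ?H" "b < c" for b c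
        using matchings_mono[OF _ _ MH' a r that] fin by auto
      have "m < ?p m" using mz by auto
      moreover have "triples321 (M \<union> H) ?p = triples321 (?M \<union> ?H) \<pi>"
        by (rule step[OF p inv img mono refl])
      moreover have "card {x \<in> ?M \<union> ?H. \<pi> x = x} = k" "card (triples321 (?M \<union> ?H) \<pi>) = r"
        using a by (simp_all add: matchings_def)
      ultimately have "m < ?p m" "card {x \<in> M \<union> H. ?p x = x} = k" "card (triples321 (M \<union> H) ?p) = r"
        unfolding fx by simp_all
      then show "?p \<in> matchings M H k r \<and> m < ?p m"
        unfolding matchings_def mem_Collect_eq using perm inv' img' by blast
    qed
  qed
  then show ?thesis by (rule bij_betw_same_card)
qed

section \<open>Recursion for the numbers of matchings\<close>

lemma card_split:
  "card (matchings M H k r) = card {\<pi> \<in> matchings M H k r. \<pi> m = m}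
     + card (matchings (M - {m}) (insert m H) k r) + card {\<pi> \<in> matchings M H k r. m < \<pi> m}"
proof -
  let ?W = "matchings M H k r"
  have "?W = ({\<pi> \<in> ?W. \<pi> m = m} \<union> {\<pi> \<in> ?W. \<pi> m < m}) \<union> {\<pi> \<in> ?W. m < \<pi> m}" by auto
  moreover have "card \<dots> = card {\<pi> \<in> ?W. \<pi> m = m} + card {\<pi> \<in> ?W. \<pi> m < m} + card {\<pi> \<in> ?W. m < \<pi> m}"
    using finite_matchings[OF fin] by (subst card_Un_disjoint; (subst card_Un_disjoint)?) auto
  ultimately show ?thesis using Max_closer by metis
qed

lemma card_fixed_many:
  assumes "2 \<le> card H" "r \<le> 1"
  shows "card {\<pi> \<in> matchings M H k r. \<pi> m = m} = 0"
proof -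
  obtain y z where "y \<in> H" "z \<in> H" "y \<noteq> z"
    using assms card_le_Suc0_iff_eq[OF fin(2)] by force
  then show ?thesis using Max_fixed_two assms by (metis (mono_tags, lifting) card.empty empty_Collect_eq)
qed

lemma card_opener_empty: "H = {} \<Longrightarrow> card {\<pi> \<in> matchings M H k r. m < \<pi> m} = 0"
  using Max_opener_image by (metis (mono_tags, lifting) card.empty empty_Collect_eq empty_iff)

text \<open>The summands belong to \<open>m\<close> fixed, joined to an unread position, and joined
  to an open arc. A fixed \<open>m\<close> costs no occurrence under no arc, uses up the permitted
  one under a single arc, and is impossible under more.\<close>

lemma card_matchings_rec:
  assumes "r \<le> 1"
  shows "card (matchings M H k r) =
    (if k = 0 then 0 else if H = {} then card (matchings (M - {m}) {} (k - 1) r)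
     else if card H = 1 \<and> r = 1 then card (matchings (M - {m}) H (k - 1) 0) else 0)
    + card (matchings (M - {m}) (insert m H) k r)
    + (if H = {} then 0 else card (matchings (M - {m}) (H - {Max H}) k r))"
proof -
  have "card {\<pi> \<in> matchings M H k r. m < \<pi> m} =
      (if H = {} then 0 else card (matchings (M - {m}) (H - {Max H}) k r))"
    using card_opener_empty Max_opener[of "Max H" r k] fin assms by simp
  moreover have "card {\<pi> \<in> matchings M H k r. \<pi> m = m} =
    (if k = 0 then 0 else if H = {} then card (matchings (M - {m}) {} (k - 1) r)
     else if card H = 1 \<and> r = 1 then card (matchings (M - {m}) H (k - 1) 0) else 0)"
  proof (cases k)
    case 0
    then have "{\<pi> \<in> matchings M H k r. \<pi> m = m} = {}" using Max_fixed_0 by blast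
    then show ?thesis unfolding 0 by (metis card.empty)
  next
    case (Suc k')
    consider "H = {}" | y where "H = {y}" | "2 \<le> card H"
      using fin(2) by (metis card_0_eq card_1_singletonE less_2_cases not_less One_nat_def)
    then show ?thesis
    proof cases
      case 1
      then show ?thesis using Max_fixed_empty[of k' r] Suc by simp
    next
      case 2
      consider "r = 0" | "r = 1" using assms by linarith
      then show ?thesis
      proof cases
        case 1
        then show ?thesis using arg_cong[OF Max_fixed_single(2)[OF 2, of k], of card] 2 by simp
      next
        case r: 2
        then show ?thesis using Max_fixed_single(1)[OF 2, of k' 0] 2 Suc by simp
      qed
    next
      case 3
      then show ?thesis using card_fixed_many assms by auto
    qed
  qed
  ultimately show ?thesis using card_split by simp
qed

end

section \<open>Ballot numbers and the solution of the recursion\<close>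

text \<open>The number of paths of \<open>n\<close> steps +1 or -1 from height \<open>k\<close> to 0
  that never go below 0. In the recursion without occurrences the height is the number of fixed
  points still to come plus the number of open arcs.\<close>

fun ballot :: "nat \<Rightarrow> nat \<Rightarrow> nat" where
  "ballot 0 k = (if k = 0 then 1 else 0)"
| "ballot (Suc n) 0 = ballot n 1"
| "ballot (Suc n) (Suc k) = ballot n k + ballot n (k + 2)"

lemma triples321_empty: "triples321 {} \<pi> = {}"
  by (auto simp: triples321_def)

lemma card_matchings_empty:
  "card (matchings {} H k r) = (if H = {} \<and> k = 0 \<and> r = 0 then 1 else 0)"
proof (cases "H = {}")
  case True
  have "\<pi> \<in> matchings {} H k r \<longleftrightarrow> \<pi> = id \<and> k = 0 \<and> r = 0" for \<pi>
    using True by (auto simp: matchings_def triples321_empty)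
  then have "matchings {} H k r = (if k = 0 \<and> r = 0 then {id} else {})" by auto
  then show ?thesis using True by simp
qed (auto simp: matchings_def)

text \<open>The extra term for \<open>H \<noteq> {}\<close> comes from the paths on which no fixed point lies to the right
  of the covered one and the height stays positive from that point on.\<close>

lemma card_matchings:
  assumes "finite M" "finite H" "\<And>x y. x \<in> M \<Longrightarrow> y \<in> H \<Longrightarrow> x < y"
  shows "card (matchings M H k 0) = ballot (card M) (k + card H) \<and>
    card (matchings M H k 1) = k * ballot (card M) (k + card H + 2)
      + (if k = 0 \<or> H = {} then 0 else ballot (card M) (k + card H))"
  using assms
proof (induction "card M" arbitrary: M H k)
  case 0
  then have "M = {}" by simp
  then show ?case using 0 by (simp add: card_matchings_empty)
next
  case (Suc n)
  note IH = Suc.hyps(1) and n = Suc.hyps(2) and M = Suc.prems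
  show ?case
  proof -
    define m M' where "m = Max M" and "M' = M - {m}"
    have m: "m \<in> M" "\<And>x. x \<in> M \<Longrightarrow> x \<le> m"
      using n M(1) unfolding m_def by (metis Max_in card.empty nat.distinct(1)) (use M(1) in simp)
    have M': "n = card M'" "finite M'" using n m(1) M(1) by (auto simp: M'_def)
    have lt: "x < m" if "x \<in> M'" for x using that m by (force simp: M'_def)
    have mH: "m \<notin> H" using M(3) m by blast
    have rec: "card (matchings M H k r) =
        (if k = 0 then 0 else if H = {} then card (matchings M' {} (k - 1) r)
         else if card H = 1 \<and> r = 1 then card (matchings M' H (k - 1) 0) else 0)
        + card (matchings M' (insert m H) k r)
        + (if H = {} then 0 else card (matchings M' (H - {Max H}) k r))" if "r \<le> 1" for r
      unfolding M'_def by (rule card_matchings_rec[OF M(1,2)]) (use M(3) m that in auto)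
    have H1: "card (insert m H) = Suc (card H)" using mH M by simp
    \<comment> \<open>The induction hypothesis for every set of open arcs that the recursion
      produces.\<close>
    have sub: "card (matchings M' A j 0) = ballot n (j + card A)"
      "card (matchings M' A j (Suc 0)) = j * ballot n (j + card A + 2)
        + (if j = 0 \<or> A = {} then 0 else ballot n (j + card A))"
      if "A \<subseteq> insert m H" for A j
    proof -
      have A: "finite A" using that M finite_subset by blast
      have "x < y" if "x \<in> M'" "y \<in> A" for x y
        using that \<open>A \<subseteq> insert m H\<close> lt M(3) by (auto simp: M'_def)
      then show "card (matchings M' A j 0) = ballot n (j + card A)"
        "card (matchings M' A j (Suc 0)) = j * ballot n (j + card A + 2)
        + (if j = 0 \<or> A = {} then 0 else ballot n (j + card A))"
        using IH[OF M' A, of j] M'(1) by auto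
    qed
    show ?thesis
    proof (cases "H = {}")
      case True
      \<comment> \<open>For \<open>k > 0\<close> a fixed \<open>m\<close> contributes
        \<open>(k - 1) * ballot n (k + 1)\<close>; the extra term for the new open arc adds the
        missing \<open>ballot n (k + 1)\<close>.\<close>
      show ?thesis
        unfolding rec[OF zero_le_one] rec[OF order_refl] using True sub n[symmetric]
        by (cases k) (simp_all add: algebra_simps)
    next
      case False
      then have z: "Max H \<in> H" using M by simp
      obtain h where h: "card H = Suc h" using False M by (metis card_eq_0_iff not0_implies_Suc)
      have cz: "card (H - {Max H}) = h" using z h by simp
      have ez: "H \<subseteq> {Max H} \<longleftrightarrow> h = 0" using cz M by (metis Diff_eq_empty_iff card_0_eq finite_Diff)
      have subs: "H - {Max H} \<subseteq> insert m H" "H \<subseteq> insert m H" by auto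
      \<comment> \<open>For \<open>h = 0\<close> the last arc is removed, so its extra term is
        absent. If \<open>k > 0\<close>, the fixed point under the single arc supplies the missing
        \<open>ballot n k\<close>.\<close>
      show ?thesis
        unfolding rec[OF zero_le_one] rec[OF order_refl] using False n[symmetric]
        by (cases k; cases h) (simp_all add: sub[OF subs(1)] sub[OF subs(2)] sub[OF order_refl] H1 h cz ez algebra_simps)
    qed
  qed
qed

section \<open>Closed form of the ballot numbers\<close>

lemma ballot_eq_0: "n < k \<Longrightarrow> ballot n k = 0"
  by (induction n k rule: ballot.induct) auto

text \<open>The reflection principle, with the reflected paths on the left so that no subtraction
  truncates.\<close>

lemma ballot_binomial:
  "ballot (2 * j + k) k + (if j = 0 then 0 else (2 * j + k) choose (j - 1)) = (2 * j + k) choose j"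
proof (induction "2 * j + k" arbitrary: j k)
  case 0
  then show ?case by simp
next
  case (Suc n)
  show ?case
  proof (cases k)
    case 0
    then obtain i where i: "j = Suc i" using Suc.hyps(2) by (cases j) auto
    then have "n = 2 * i + 1" using Suc.hyps(2) 0 by simp
    then have *: "ballot n 1 + (if i = 0 then 0 else n choose (i - 1)) = n choose i"
      using Suc.hyps(1)[of i 1] by metis
    \<comment> \<open>At height 0 only the up step exists; the equal middle coefficients of the odd
      row \<open>n\<close> make up for the other one.\<close>
    moreover have "n choose Suc i = n choose i"
      using binomial_symmetric[of i n] \<open>n = 2 * i + 1\<close> by simp
    ultimately show ?thesis
      unfolding Suc.hyps(2)[symmetric] unfolding 0 i
      by (cases i) (simp_all del: ballot.simps add: ballot.simps(2))
  next
    case (Suc l)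
    then have n: "n = 2 * j + l" using Suc.hyps(2) by simp
    show ?thesis
    proof (cases j)
      case 0
      \<comment> \<open>\<open>j\<close> counts the up steps. Without any the path descends
        throughout, and height \<open>l + 2\<close> is too high for the \<open>l\<close> steps
        left.\<close>
      then show ?thesis using n Suc.hyps(1)[of 0 l] \<open>k = Suc l\<close> ballot_eq_0[of l "l + 2"] by simp
    next
      case (Suc i)
      \<comment> \<open>After an up step \<open>i\<close> of them remain and the height is
        \<open>l + 2\<close>; Pascal's rule then adds the two hypotheses.\<close>
      have "n = 2 * i + (l + 2)" using n Suc by simp
      then show ?thesis
        unfolding Suc.hyps(2)[symmetric] unfolding \<open>k = Suc l\<close>
        using Suc.hyps(1)[OF n] Suc.hyps(1)[of i "l + 2"] Suc n by (cases i) (auto)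
    qed
  qed
qed

text \<open>After multiplication by \<open>n + 1\<close>, absorption turns both binomials of the
  reflection formula into multiples of \<open>Suc n choose j\<close>, with factors
  \<open>n + 1 - j\<close> and \<open>j\<close>, whose difference is \<open>k + 1\<close>.\<close>

lemma ballot_closed_form:
  "real (ballot (2 * j + k) k) = real (k + 1) / real (2 * j + k + 1) * real ((2 * j + k + 1) choose j)"
proof -
  define n where "n = 2 * j + k"
  have A: "real (n + 1 - j) * real (Suc n choose j) = real (n + 1) * real (n choose j)"
    using binomial_absorb_comp[of "Suc n" j] by (metis Suc_eq_plus1 diff_Suc_1 of_nat_mult)
  have B: "real j * real (Suc n choose j) = real (n + 1) * real (if j = 0 then 0 else n choose (j - 1))"
    using Suc_times_binomial[of "j - 1" n, THEN arg_cong[of _ _ real]]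
    by (cases j) (simp_all del: binomial_Suc_Suc add: algebra_simps)
  have "real (ballot n k) = real (n choose j) - real (if j = 0 then 0 else n choose (j - 1))"
    using ballot_binomial[of j k] unfolding n_def by (metis add_diff_cancel_right' of_nat_add)
  then have "real (n + 1) * real (ballot n k) = real (n + 1 - j) * real (Suc n choose j) - real j * real (Suc n choose j)"
    unfolding A B by (simp add: right_diff_distrib)
  also have "\<dots> = real (k + 1) * real (Suc n choose j)"
    unfolding left_diff_distrib[symmetric] by (simp add: n_def of_nat_diff)
  finally show ?thesis unfolding n_def[symmetric] by (simp add: field_simps)
qed

section \<open>From occurrences to triples, and the final count\<close>

lemma order_isomorphic_321:
  "order_isomorphic xs [3, 2, 1] \<longleftrightarrow> (\<exists>x y z. xs = [x, y, z] \<and> z < y \<and> y < x)"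
proof
  assume a: "order_isomorphic xs [3, 2, 1]"
  then obtain x y z where xs: "xs = [x, y, z]"
    by (auto simp: order_isomorphic_def length_Suc_conv numeral_3_eq_3)
  have lt: "xs ! i < xs ! j \<longleftrightarrow> [3, 2, 1 :: nat] ! i < [3, 2, 1] ! j" if "i < 3" "j < 3" for i j
    using a that unfolding order_isomorphic_def xs by auto
  show "\<exists>x y z. xs = [x, y, z] \<and> z < y \<and> y < x"
    using lt[of 2 1] lt[of 1 0] xs by auto
next
  assume "\<exists>x y z. xs = [x, y, z] \<and> z < y \<and> y < x"
  then show "order_isomorphic xs [3, 2, 1]"
    by (auto simp: order_isomorphic_def less_Suc_eq numeral_3_eq_3)
qed

lemma sorted_list_of_set_3:
  fixes a b c :: nat
  assumes "a < b" "b < c"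
  shows "sorted_list_of_set {a, b, c} = [a, b, c]"
  using assms sorted_list_of_set.idem_if_sorted_distinct[of "[a, b, c]"] by simp

text \<open>Sorting an index set recovers its triple, so forgetting the order is a
  bijection.\<close>

lemma card_occurrences_321: "card (occurrences [3, 2, 1] n \<pi>) = card (triples321 {1..n} \<pi>)"
proof -
  have "bij_betw (\<lambda>(a, b, c). {a, b, c}) (triples321 {1..n} \<pi>) (occurrences [3, 2, 1] n \<pi>)"
  proof (rule bij_betw_imageI)
    show "inj_on (\<lambda>(a, b, c). {a, b, c}) (triples321 {1..n} \<pi>)"
    proof (rule inj_onI, unfold split_paired_all prod.case)
      fix a b c a' b' c'
      assume "(a, b, c) \<in> triples321 {1..n} \<pi>" "(a', b', c') \<in> triples321 {1..n} \<pi>"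
        and eq: "{a, b, c} = {a', b', c'}"
      then have "a < b" "b < c" "a' < b'" "b' < c'" by (auto simp: triples321_def)
      then have "[a, b, c] = [a', b', c']" using eq sorted_list_of_set_3 by metis
      then show "(a, b, c) = (a', b', c')" by simp
    qed
    show "(\<lambda>(a, b, c). {a, b, c}) ` triples321 {1..n} \<pi> = occurrences [3, 2, 1] n \<pi>"
    proof (intro equalityI subsetI)
      fix I assume "I \<in> (\<lambda>(a, b, c). {a, b, c}) ` triples321 {1..n} \<pi>"
      then obtain a b c where "I = {a, b, c}" "(a, b, c) \<in> triples321 {1..n} \<pi>" by auto
      then show "I \<in> occurrences [3, 2, 1] n \<pi>"
        by (auto simp: occurrences_def order_isomorphic_321 triples321_def sorted_list_of_set_3
            simp del: One_nat_def)
    next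
      fix I assume I: "I \<in> occurrences [3, 2, 1] n \<pi>"
      then have sub: "I \<subseteq> {1..n}" by (simp add: occurrences_def)
      then have fin: "finite I" by (rule finite_subset) simp
      obtain a b c where abc: "sorted_list_of_set I = [a, b, c]" "\<pi> c < \<pi> b" "\<pi> b < \<pi> a"
        using I by (auto simp: occurrences_def order_isomorphic_321 simp del: One_nat_def)
      have "I = {a, b, c}" using abc(1) set_sorted_list_of_set[OF fin] by simp
      moreover have "a < b" "b < c"
        using abc(1) strict_sorted_list_of_set[of I] by simp_all
      ultimately show "I \<in> (\<lambda>(a, b, c). {a, b, c}) ` triples321 {1..n} \<pi>"
        using abc sub by (auto simp: triples321_def intro!: image_eqI[of _ _ "(a, b, c)"])
    qed
  qed
  then show ?thesis by (metis bij_betw_same_card)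
qed

text \<open>The scan starts with every position unread and no arc open.\<close>

lemma num_involutions_once_321: "num_involutions_once n k [3, 2, 1] = card (matchings {1..n} {} k 1)"
proof -
  have "inv \<pi> = \<pi> \<longleftrightarrow> (\<forall>x. \<pi> (\<pi> x) = x)" if "\<pi> permutes {1..n}" for \<pi>
    using that by (metis inv_unique_comp comp_apply eq_id_iff permutes_inverses(2))
  then have "{\<pi> \<in> involutions n. card (fixed_points n \<pi>) = k \<and> card (occurrences [3, 2, 1] n \<pi>) = 1}
      = matchings {1..n} {} k 1"
    unfolding involutions_def matchings_def fixed_points_def card_occurrences_321 by auto
  then show ?thesis unfolding num_involutions_once_def by simp
qed

theorem theorem3p7:
  fixes n k :: nat
  assumes "n \<ge> 3" and "k \<le> n" and "even (n + k)"
  shows "real (num_involutions_once n k [3, 2, 1]) =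
    real (k * (k + 3)) / real (n + 1) * real (int_choose (n + 1) ((int n - int k) div 2 - 1))"
proof -
  have count: "num_involutions_once n k [3, 2, 1] = k * ballot n (k + 2)"
    unfolding num_involutions_once_321 using card_matchings[of "{1..n}" "{}" k] by simp
  obtain j where j: "n = 2 * j + k"
    using assms by (metis even_diff_nat evenE le_add_diff_inverse2)
  show ?thesis
  proof (cases j)
    case 0
    \<comment> \<open>The lower index is -1 and the ballot path starts too high, so both sides are
      0.\<close>
    then show ?thesis using j unfolding count by (simp add: ballot_eq_0 int_choose_def)
  next
    case (Suc i)
    \<comment> \<open>Starting at height \<open>k + 2\<close> leaves \<open>i = j - 1\<close> up
      steps, since \<open>n = 2 * i + (k + 2)\<close>.\<close>
    have "real (ballot n (k + 2)) = real (k + 3) / real (n + 1) * real ((n + 1) choose i)"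
      using ballot_closed_form[of i "k + 2"] j Suc by (simp add: algebra_simps)
    moreover have "int_choose (n + 1) ((int n - int k) div 2 - 1) = (n + 1) choose i"
      using j Suc by (simp add: int_choose_def)
    ultimately show ?thesis unfolding count by simp
  qed
qed

end
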